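(* Let $(X,d,\ll,\leq,\tau)$ be an intrinsic Lorentzian pre-length space, let $\Omega\colon X\to(0,+\infty)$ be continuous, and consider the conformally transformed space $(X,d,\ll_\Omega,\leq_\Omega,\tau_\Omega)$. If $(X,d,\ll,\leq,\tau)$ satisfies any one of the following conditions, then $(X,d,\ll_\Omega,\leq_\Omega,\tau_\Omega)$ satisfies the same condition: (i) chronological; (ii) causal; (iii) non-totally imprisoning; (iv) distinguishing; (v) strongly causal; (vi) stably causal; (vii) causally continuous; (viii) causally simple; (ix) globally hyperbolic; ( * ) forward complete.
   Context: A Lorentzian pre-length space $(X,d,\ll,\leq,\tau)$ consists of a set $X$, a metric $d$ on $X$, two transitive relations $\ll,\leq$ on $X$ with $\leq$ reflexive and $\ll$ contained in $\leq$, and a map $\tau\colon X\times X\to[0,+\infty]$ which is lower semicontinuous with respect to the topology of $d$, satisfies $\tau(x,z)\geq\tau(x,y)+\tau(y,z)$ whenever $x\leq y\leq z$, satisfies $\tau(x,y)=0$ if $x\not\leq y$, and satisfies $\tau(x,y)>0$ if and only if $x\ll y$. A curve is a continuous map from an interval into $X$. A non-constant curve $\gamma\colon I\to X$ is causal if $\gamma(t)\leq\gamma(s)$ for all $t<s$ in $I$. A causal curve from $x$ to $y$ is one defined on a compact interval, starting at $x$ and ending at $y$. For a causal curve $\gamma\colon[a,b]\to X$ put $$L_\Omega^\tau(\gamma):=\inf\Big\{\sum_{i=0}^{m-1}\max_{t\in[t_i,t_{i+1}]}\Omega(\gamma(t))\,\tau(\gamma(t_i),\gamma(t_{i+1}))\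 :\ a=t_0<\dots<t_m=b\Big\},$$ and let $L^\tau(\gamma)$ be the same quantity with $\Omega\equiv1$. Define $$\tau_\Omega(x,y):=\sup\big(\{0\}\cup\{L_\Omega^\tau(\gamma):\gamma\text{ a causal curve from }x\text{ to }y\}\big),$$ $x\ll_\Omega y:\iff\tau_\Omega(x,y)>0$, and $x\leq_\Omega y:\iff x\leq y$. The space is intrinsic if $\tau(x,y)=\sup(\{0\}\cup\{L^\tau(\gamma):\gamma\text{ a causal curve from }x\text{ to }y\})$ for all $x,y$. The function $\tau_\Omega$ is not required to be lower semicontinuous here; the conditions below involve only $d$ and the two relations. With $I^+(x)=\{z:x\ll z\}$, $I^-(x)=\{z:z\ll x\}$, $J^+(x)=\{z:x\leq z\}$, $J^-(x)=\{z:z\leq x\}$, a space is: (i) chronological if $x\not\ll x$ for all $x$; (ii) causal if $x\leq y$ and $y\leq x$ imply $x=y$; (iii) non-totally imprisoning if for every compact $K\subseteq X$ there is $C>0$ bounding from above the $d$-length of every causal curve contained in $K$; (iv) distinguishing if for all $x,y$, $I^+(x)=I^+(y)$ or $I^-(x)=I^-(y)$ implies $x=y$; (v) strongly causal if $\{I^+(x)\cap I^-(y):x,y\in X\}$ is a subbase of the topology induced by $d$; (vi) stably causal if the smallest closed relation containing $\leq$ is antisymmetric; (vii) causally continuous if it is distinguishing and for all $x,y$: $I^+(x)\subset I^+(y)\Rightarrow I^-(y)\subset I^-(x)$, and $I^-(x)\subset I^-(y)\Rightarrow I^+(y)\subset I^+(x)$; (viii) causally simple if it is causal and $J^+(x),J^-(x)$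 are closed for all $x$; (ix) globally hyperbolic if it is non-totally imprisoning and $J^+(x)\cap J^-(y)$ is compact for all $x,y$; ( * ) forward complete if every sequence $(x_n)_n$ with $x_n\leq x_{n+1}\leq z$ for all $n$ and some $z\in X$ converges in $X$. *)

theory Defs
  imports "HOL-Analysis.Analysis"
begin

text \<open>
  The underlying set \<open>X\<close> is a type of class \<open>metric_space\<close>, which supplies the metric \<open>d\<close>.
  The record carries the remaining data: \<open>chron\<close> is \<open>\<lless>\<close>, \<open>cau\<close> is \<open>\<le>\<close> and \<open>tsep\<close> is \<open>\<tau>\<close>.
\<close>

record 'a lorentzian_space =
  chron :: "'a \<Rightarrow> 'a \<Rightarrow> bool"
  cau :: "'a \<Rightarrow> 'a \<Rightarrow> bool"
  tsep :: "'a \<Rightarrow> 'a \<Rightarrow> ennreal"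

definition lower_semicontinuous :: "('a::topological_space \<Rightarrow> 'b::linorder) \<Rightarrow> bool" where
  "lower_semicontinuous f \<longleftrightarrow> (\<forall>c. open {x. c < f x})"

definition lorentzian_pre_length_space :: "'a::metric_space lorentzian_space \<Rightarrow> bool" where
  "lorentzian_pre_length_space M \<longleftrightarrow>
     transp (chron M) \<and> transp (cau M) \<and> reflp (cau M) \<and>
     (\<forall>x y. chron M x y \<longrightarrow> cau M x y) \<and>
     lower_semicontinuous (\<lambda>p. tsep M (fst p) (snd p)) \<and>
     (\<forall>x y z. cau M x y \<longrightarrow> cau M y z \<longrightarrow> tsep M x z \<ge> tsep M x y + tsep M y z) \<and>
     (\<forall>x y. \<not> cau M x y \<longrightarrow> tsep M x y = 0) \<and>
     (\<forall>x y. tsep M x y > 0 \<longleftrightarrow> chron M x y)"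

definition causal_curve :: "'a::metric_space lorentzian_space \<Rightarrow> real set \<Rightarrow> (real \<Rightarrow> 'a) \<Rightarrow> bool" where
  "causal_curve M I \<gamma> \<longleftrightarrow>
     is_interval I \<and> continuous_on I \<gamma> \<and> \<not> \<gamma> constant_on I \<and>
     (\<forall>t\<in>I. \<forall>s\<in>I. t < s \<longrightarrow> cau M (\<gamma> t) (\<gamma> s))"

text \<open>A pair \<open>(m, t)\<close> encodes the points \<open>t 0 < \<dots> < t m\<close>; values of \<open>t\<close> beyond \<open>m\<close> are irrelevant.\<close>

definition chains :: "real set \<Rightarrow> (nat \<times> (nat \<Rightarrow> real)) set" where
  "chains I = {(m, t). (\<forall>i\<le>m. t i \<in> I) \<and> (\<forall>i<m. t i < t (Suc i))}"

definition partitions :: "real \<Rightarrow> real \<Rightarrow> (nat \<times> (nat \<Rightarrow> real)) set" where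
  "partitions a b = {(m, t) \<in> chains {a..b}. t 0 = a \<and> t m = b}"

text \<open>
  For continuous \<open>\<Omega>\<close> and \<open>\<gamma>\<close> the supremum over the compact interval below is attained,
  so it is the maximum (HOL's \<open>Max\<close> is meaningful for finite sets only).
\<close>

definition weighted_length ::
    "'a::metric_space lorentzian_space \<Rightarrow> ('a \<Rightarrow> real) \<Rightarrow> real \<Rightarrow> real \<Rightarrow> (real \<Rightarrow> 'a) \<Rightarrow> ennreal" where
  "weighted_length M \<Omega> a b \<gamma> =
     (INF (m, t)\<in>partitions a b.
        \<Sum>i<m. (SUP s\<in>{t i..t (Suc i)}. ennreal (\<Omega> (\<gamma> s))) * tsep M (\<gamma> (t i)) (\<gamma> (t (Suc i))))"

definition weighted_tsep ::
    "'a::metric_space lorentzian_space \<Rightarrow> ('a \<Rightarrow> real) \<Rightarrow> 'a \<Rightarrow> 'a \<Rightarrow> ennreal" where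
  "weighted_tsep M \<Omega> x y =
     Sup ({0} \<union> {weighted_length M \<Omega> a b \<gamma> | a b \<gamma>.
                    causal_curve M {a..b} \<gamma> \<and> \<gamma> a = x \<and> \<gamma> b = y})"

definition intrinsic :: "'a::metric_space lorentzian_space \<Rightarrow> bool" where
  "intrinsic M \<longleftrightarrow> (\<forall>x y. tsep M x y = weighted_tsep M (\<lambda>_. 1) x y)"

definition conformal ::
    "('a \<Rightarrow> real) \<Rightarrow> 'a::metric_space lorentzian_space \<Rightarrow> 'a lorentzian_space" where
  "conformal \<Omega> M =
     \<lparr>chron = (\<lambda>x y. weighted_tsep M \<Omega> x y > 0), cau = cau M, tsep = weighted_tsep M \<Omega>\<rparr>"

definition I_plus :: "'a lorentzian_space \<Rightarrow> 'a \<Rightarrow> 'a set" where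
  "I_plus M x = {z. chron M x z}"

definition I_minus :: "'a lorentzian_space \<Rightarrow> 'a \<Rightarrow> 'a set" where
  "I_minus M x = {z. chron M z x}"

definition J_plus :: "'a lorentzian_space \<Rightarrow> 'a \<Rightarrow> 'a set" where
  "J_plus M x = {z. cau M x z}"

definition J_minus :: "'a lorentzian_space \<Rightarrow> 'a \<Rightarrow> 'a set" where
  "J_minus M x = {z. cau M z x}"

definition metric_length :: "real set \<Rightarrow> (real \<Rightarrow> 'a::metric_space) \<Rightarrow> ennreal" where
  "metric_length I \<gamma> = (SUP (m, t)\<in>chains I. \<Sum>i<m. ennreal (dist (\<gamma> (t i)) (\<gamma> (t (Suc i)))))"

definition chronological :: "'a lorentzian_space \<Rightarrow> bool" where
  "chronological M \<longleftrightarrow> (\<forall>x. \<not> chron M x x)"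

definition causal :: "'a lorentzian_space \<Rightarrow> bool" where
  "causal M \<longleftrightarrow> (\<forall>x y. cau M x y \<and> cau M y x \<longrightarrow> x = y)"

definition non_totally_imprisoning :: "'a::metric_space lorentzian_space \<Rightarrow> bool" where
  "non_totally_imprisoning M \<longleftrightarrow>
     (\<forall>K. compact K \<longrightarrow>
        (\<exists>C::real. C > 0 \<and>
           (\<forall>I \<gamma>. causal_curve M I \<gamma> \<and> \<gamma> ` I \<subseteq> K \<longrightarrow> metric_length I \<gamma> \<le> ennreal C)))"

definition distinguishing :: "'a lorentzian_space \<Rightarrow> bool" where
  "distinguishing M \<longleftrightarrow>
     (\<forall>x y. I_plus M x = I_plus M y \<or> I_minus M x = I_minus M y \<longrightarrow> x = y)"

text \<open>
  \<open>generate_topology\<close> always includes the whole space (the empty intersection), as is usual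
  for the topology generated by a subbase.
\<close>

definition strongly_causal :: "'a::metric_space lorentzian_space \<Rightarrow> bool" where
  "strongly_causal M \<longleftrightarrow>
     (open :: 'a set \<Rightarrow> bool) = generate_topology {I_plus M x \<inter> I_minus M y | x y. True}"

definition stably_causal :: "'a::metric_space lorentzian_space \<Rightarrow> bool" where
  "stably_causal M \<longleftrightarrow> antisym (closed hull {(x, y). cau M x y})"

definition causally_continuous :: "'a lorentzian_space \<Rightarrow> bool" where
  "causally_continuous M \<longleftrightarrow>
     distinguishing M \<and>
     (\<forall>x y. (I_plus M x \<subseteq> I_plus M y \<longrightarrow> I_minus M y \<subseteq> I_minus M x) \<and>
            (I_minus M x \<subseteq> I_minus M y \<longrightarrow> I_plus M y \<subseteq> I_plus M x))"

definition causally_simple :: "'a::metric_space lorentzian_space \<Rightarrow> bool" where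
  "causally_simple M \<longleftrightarrow> causal M \<and> (\<forall>x. closed (J_plus M x) \<and> closed (J_minus M x))"

definition globally_hyperbolic :: "'a::metric_space lorentzian_space \<Rightarrow> bool" where
  "globally_hyperbolic M \<longleftrightarrow>
     non_totally_imprisoning M \<and> (\<forall>x y. compact (J_plus M x \<inter> J_minus M y))"

definition forward_complete :: "'a::metric_space lorentzian_space \<Rightarrow> bool" where
  "forward_complete M \<longleftrightarrow>
     (\<forall>s :: nat \<Rightarrow> 'a. (\<exists>z. \<forall>n. cau M (s n) (s (Suc n)) \<and> cau M (s (Suc n)) z) \<longrightarrow> convergent s)"

end

theory Submission
  imports Defs
begin

text \<open>
  A causal curve defined on a compact interval has compact image, so along it any two positive
  continuous weights are bounded by constant multiples of each other. The corresponding weighted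
  lengths are then bounded by the same multiples of each other, and in particular vanish
  simultaneously (\<open>weighted_length_pos_transfer\<close>). The constants depend on the curve, but the
  time separation \<open>\<tau>\<^sub>\<Omega>\<close> is positive as soon as a single connecting curve has positive length, so no
  uniformity is needed: \<open>\<tau>\<^sub>\<Omega>\<close> and \<open>\<tau>\<^sub>1\<close> are positive for the same pairs of points. For an intrinsic
  space \<open>\<tau>\<^sub>1\<close> is \<open>\<tau>\<close>, whence \<open>\<lless>\<^sub>\<Omega>\<close> equals \<open>\<lless>\<close> (\<open>chron_conformal\<close>). Since \<open>\<le>\<^sub>\<Omega>\<close> equals \<open>\<le>\<close> by
  definition, and every condition of the causal ladder is formulated in terms of the metric and the
  two relations only, each is inherited by the transformed space.
\<close>

lemma weighted_length_le_mult:
  assumes k: "0 < k" and le: "\<And>s. s \<in> {a..b} \<Longrightarrow> \<Omega> (\<gamma> s) \<le> k * \<Omega>' (\<gamma> s)"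
  shows "weighted_length M \<Omega> a b \<gamma> \<le> ennreal k * weighted_length M \<Omega>' a b \<gamma>"
proof -
  define S where "S \<Omega> = (\<lambda>(m, t :: nat \<Rightarrow> real). \<Sum>i<m. (SUP s\<in>{t i..t (Suc i)}. ennreal (\<Omega> (\<gamma> s))) *
      tsep M (\<gamma> (t i)) (\<gamma> (t (Suc i))))" for \<Omega> :: "'a \<Rightarrow> real"
  have L: "weighted_length M \<Omega> a b \<gamma> = (INF p\<in>partitions a b. S \<Omega> p)" for \<Omega>
    unfolding weighted_length_def S_def ..
  have sums: "S \<Omega> p \<le> ennreal k * S \<Omega>' p" if p: "p \<in> partitions a b" for p
  proof -
    obtain m t where [simp]: "p = (m, t)" by (cases p)
    have in_ab: "t i \<in> {a..b}" if "i \<le> m" for i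
      using p that unfolding partitions_def chains_def by auto
    have "(SUP s\<in>{t i..t (Suc i)}. ennreal (\<Omega> (\<gamma> s)))
        \<le> ennreal k * (SUP s\<in>{t i..t (Suc i)}. ennreal (\<Omega>' (\<gamma> s)))" if i: "i < m" for i
    proof (rule SUP_least)
      fix s assume s: "s \<in> {t i..t (Suc i)}"
      then have "s \<in> {a..b}" using in_ab[of i] in_ab[of "Suc i"] i by auto
      then have "ennreal (\<Omega> (\<gamma> s)) \<le> ennreal k * ennreal (\<Omega>' (\<gamma> s))"
        using le k by (simp add: ennreal_mult'[symmetric] ennreal_leI)
      also have "\<dots> \<le> ennreal k * (SUP s\<in>{t i..t (Suc i)}. ennreal (\<Omega>' (\<gamma> s)))"
        using s by (intro mult_left_mono SUP_upper) auto
      finally show "ennreal (\<Omega> (\<gamma> s)) \<le> \<dots>" .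
    qed
    then show ?thesis
      by (auto simp: S_def sum_distrib_left mult.assoc[symmetric] intro!: sum_mono mult_right_mono)
  qed
  \<comment> \<open>Division by the finite constant \<open>k\<close> turns the claim into a lower bound for an infimum.\<close>
  have "weighted_length M \<Omega> a b \<gamma> / ennreal k \<le> weighted_length M \<Omega>' a b \<gamma>"
    unfolding L
  proof (rule INF_greatest)
    fix p assume p: "p \<in> partitions a b"
    have "(INF p\<in>partitions a b. S \<Omega> p) \<le> ennreal k * S \<Omega>' p"
      using sums[OF p] by (rule INF_lower2[OF p])
    then show "(INF p\<in>partitions a b. S \<Omega> p) / ennreal k \<le> S \<Omega>' p"
      using k by (auto simp: divide_le_posI_ennreal mult.commute)
  qed
  then have "ennreal k * (weighted_length M \<Omega> a b \<gamma> / ennreal k)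
      \<le> ennreal k * weighted_length M \<Omega>' a b \<gamma>"
    by (rule mult_left_mono) simp
  then show ?thesis
    using k by (simp add: ennreal_times_divide ennreal_mult_divide_eq
        mult.commute[of "ennreal k" "weighted_length M \<Omega> a b \<gamma>"])
qed

text \<open>
  The ratio \<open>\<Omega> / \<Omega>'\<close> along the curve is continuous on a compact interval, and a bound for it serves
  as the constant comparing the two lengths.
\<close>

lemma weighted_length_pos_transfer:
  fixes \<Omega> \<Omega>' :: "'a::metric_space \<Rightarrow> real"
  assumes curve: "continuous_on {a..b} \<gamma>"
    and cont: "continuous_on UNIV \<Omega>" "continuous_on UNIV \<Omega>'" and pos: "\<And>x. 0 < \<Omega>' x"
    and length: "0 < weighted_length M \<Omega> a b \<gamma>"
  shows "0 < weighted_length M \<Omega>' a b \<gamma>"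
proof -
  have "continuous_on {a..b} (\<lambda>s. \<Omega> (\<gamma> s) / \<Omega>' (\<gamma> s))"
    using pos curve by (intro continuous_on_divide continuous_on_compose2[OF cont(1)]
        continuous_on_compose2[OF cont(2)]) (auto simp: less_imp_neq[symmetric])
  then have "bounded ((\<lambda>s. \<Omega> (\<gamma> s) / \<Omega>' (\<gamma> s)) ` {a..b})"
    by (intro compact_imp_bounded compact_continuous_image) auto
  then obtain k where k: "0 < k" and ratio: "\<And>s. s \<in> {a..b} \<Longrightarrow> \<bar>\<Omega> (\<gamma> s) / \<Omega>' (\<gamma> s)\<bar> \<le> k"
    unfolding bounded_pos by auto
  have "\<Omega> (\<gamma> s) \<le> k * \<Omega>' (\<gamma> s)" if "s \<in> {a..b}" for s
    using abs_le_D1[OF ratio[OF that]] pos[of "\<gamma> s"] by (simp add: divide_le_eq)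
  from weighted_length_le_mult[where \<Omega> = \<Omega> and \<Omega>' = \<Omega>', OF k this]
  have "0 < ennreal k * weighted_length M \<Omega>' a b \<gamma>"
    using length by (rule less_le_trans[rotated])
  then show ?thesis by (auto simp: zero_less_iff_neq_zero)
qed

lemma weighted_tsep_pos_iff_curve:
  "0 < weighted_tsep M \<Omega> x y \<longleftrightarrow>
     (\<exists>a b \<gamma>. causal_curve M {a..b} \<gamma> \<and> \<gamma> a = x \<and> \<gamma> b = y \<and> 0 < weighted_length M \<Omega> a b \<gamma>)"
  unfolding weighted_tsep_def less_Sup_iff by auto

lemma weighted_tsep_pos_iff:
  fixes \<Omega> \<Omega>' :: "'a::metric_space \<Rightarrow> real"
  assumes "continuous_on UNIV \<Omega>" "continuous_on UNIV \<Omega>'"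
    and "\<And>x. 0 < \<Omega> x" "\<And>x. 0 < \<Omega>' x"
  shows "0 < weighted_tsep M \<Omega> x y \<longleftrightarrow> 0 < weighted_tsep M \<Omega>' x y"
proof -
  have "0 < weighted_length M \<Omega> a b \<gamma> \<longleftrightarrow> 0 < weighted_length M \<Omega>' a b \<gamma>"
    if "causal_curve M {a..b} \<gamma>" for a b \<gamma>
    using that assms weighted_length_pos_transfer[of a b \<gamma>] unfolding causal_curve_def by blast
  then show ?thesis
    unfolding weighted_tsep_pos_iff_curve by blast
qed

lemma chron_conformal:
  fixes M :: "'a::metric_space lorentzian_space"
  assumes "lorentzian_pre_length_space M" "intrinsic M" "continuous_on UNIV \<Omega>" "\<And>x. 0 < \<Omega> x"
  shows "chron (conformal \<Omega> M) = chron M"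
proof (intro ext)
  fix x y
  have "chron (conformal \<Omega> M) x y \<longleftrightarrow> 0 < weighted_tsep M (\<lambda>_. 1) x y"
    unfolding conformal_def using assms by (simp add: weighted_tsep_pos_iff[of \<Omega> "\<lambda>_. 1"])
  also have "\<dots> \<longleftrightarrow> chron M x y"
    using assms(1,2) unfolding intrinsic_def lorentzian_pre_length_space_def by metis
  finally show "chron (conformal \<Omega> M) x y = chron M x y" .
qed

theorem proposition4p4:
  fixes M :: "'a::metric_space lorentzian_space" and \<Omega> :: "'a \<Rightarrow> real"
  assumes "lorentzian_pre_length_space M" and "intrinsic M"
    and "continuous_on UNIV \<Omega>" and "\<forall>x. \<Omega> x > 0"
  shows "(chronological M \<longrightarrow> chronological (conformal \<Omega> M)) \<and>
    (causal M \<longrightarrow> causal (conformal \<Omega> M)) \<and>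
    (non_totally_imprisoning M \<longrightarrow> non_totally_imprisoning (conformal \<Omega> M)) \<and>
    (distinguishing M \<longrightarrow> distinguishing (conformal \<Omega> M)) \<and>
    (strongly_causal M \<longrightarrow> strongly_causal (conformal \<Omega> M)) \<and>
    (stably_causal M \<longrightarrow> stably_causal (conformal \<Omega> M)) \<and>
    (causally_continuous M \<longrightarrow> causally_continuous (conformal \<Omega> M)) \<and>
    (causally_simple M \<longrightarrow> causally_simple (conformal \<Omega> M)) \<and>
    (globally_hyperbolic M \<longrightarrow> globally_hyperbolic (conformal \<Omega> M)) \<and>
    (forward_complete M \<longrightarrow> forward_complete (conformal \<Omega> M))"
proof -
  let ?N = "conformal \<Omega> M"
  have chron: "chron ?N = chron M"
    using assms by (intro chron_conformal) auto
  have cau: "cau ?N = cau M"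
    by (simp add: conformal_def)
  have I: "I_plus ?N = I_plus M" "I_minus ?N = I_minus M"
    by (simp_all add: fun_eq_iff I_plus_def I_minus_def chron)
  have J: "J_plus ?N = J_plus M" "J_minus ?N = J_minus M"
    by (simp_all add: fun_eq_iff J_plus_def J_minus_def cau)
  have curves: "causal_curve ?N = causal_curve M"
    by (simp add: fun_eq_iff causal_curve_def cau)
  have "chronological ?N = chronological M" "causal ?N = causal M"
    "non_totally_imprisoning ?N = non_totally_imprisoning M"
    "distinguishing ?N = distinguishing M" "strongly_causal ?N = strongly_causal M"
    "stably_causal ?N = stably_causal M" "forward_complete ?N = forward_complete M"
    by (simp_all only: chronological_def causal_def non_totally_imprisoning_def distinguishing_def
        strongly_causal_def stably_causal_def forward_complete_def chron cau I curves)
  then show ?thesis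
    by (simp add: causally_continuous_def causally_simple_def globally_hyperbolic_def I J)
qed

end
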